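(* Let $\mathcal{C}$ be a Riemannian manifold and let $\eta$ be a map assigning to each $(y,x)\in\mathcal{C}\times\mathcal{C}$ a tangent vector $\eta(y,x)\in T_x\mathcal{C}$, with $\mathcal{C}$ an $\eta$-invex set. Let $f:\mathcal{C}\to\mathbb{R}$ be $L$-smooth (with respect to $\eta$) for some $L>0$, and suppose $f^*=\min_{x\in\mathcal{C}}f(x)\ge B$ for some $B>-\infty$. Let $\alpha\in(0,\frac{2}{L})$ and let $(x_k)_{k\ge 0}$ be a sequence in $\mathcal{C}$ produced by invex gradient descent with constant step size $\alpha$, i.e. $\eta(x_{k+1},x_k)=-\alpha\nabla f(x_k)$ for all $k\ge 0$. Then $\lim_{k\to\infty}\|\nabla f(x_k)\|=0$.
   Context: $\langle\cdot,\cdot\rangle_x$ is the inner product on $T_x\mathcal{C}$ given by the Riemannian metric, $\|\cdot\|$ (or $\|\cdot\|_x$) is the induced norm on $T_x\mathcal{C}$, and $\nabla f(x)\in T_x\mathcal{C}$ is the Riemannian gradient. $\eta$-invex set: a set $\mathcal{A}\subseteq\mathcal{C}$ is $\eta$-invex if it contains every differentiable curve $\gamma_{x,y}:[0,1]\to\mathcal{C}$ with endpoints $\gamma_{x,y}(0)=x\in\mathcal{A}$, $\gamma_{x,y}(1)=y\in\mathcal{A}$ satisfying $\dot\gamma_{x,y}(u)(t-u)=\eta(\gamma_{x,y}(t),\gamma_{x,y}(u))$ for all $t,u\in[0,1]$. $L$-smooth: a differentiable $f:\mathcal{C}\to\mathbb{R}$ is $L$-smooth (with respect to $\eta$) if for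 all $x,y\in\mathcal{C}$, $f(y)\le f(x)+\langle\eta(y,x),\nabla f(x)\rangle_x+\frac{L}{2}\|\eta(y,x)\|_x^2$. (The function $f$ is not assumed invex here.) *)

theory Defs
  imports "HOL-Analysis.Analysis"
begin

section \<open>Smooth maps on open subsets of a normed space\<close>

primrec Ck_on :: "nat \<Rightarrow> ('a::real_normed_vector \<Rightarrow> 'b::real_normed_vector) \<Rightarrow> 'a set \<Rightarrow> bool"
  where
    "Ck_on 0 f S \<longleftrightarrow> continuous_on S f"
  | "Ck_on (Suc k) f S \<longleftrightarrow>
       (\<forall>x\<in>S. f differentiable (at x)) \<and>
       (\<forall>v. Ck_on k (\<lambda>x. frechet_derivative f (at x) v) S)"

definition smooth_on :: "('a::real_normed_vector \<Rightarrow> 'b::real_normed_vector) \<Rightarrow> 'a set \<Rightarrow> bool"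
  where "smooth_on f S \<longleftrightarrow> (\<forall>k. Ck_on k f S)"


section \<open>Smooth manifolds\<close>

text \<open>
  A chart is a pair of its domain and a map to the model space; values of the map outside the
  domain are irrelevant. The underlying set of a manifold is the carrier of a topology \<open>X\<close>.
  The model space is any finite-dimensional normed space. This includes every Euclidean space and,
  unlike the class \<open>euclidean_space\<close>, also dimension zero.
\<close>

type_synonym ('a, 'e) chart = "'a set \<times> ('a \<Rightarrow> 'e)"

abbreviation chart_inv :: "('a, 'e) chart \<Rightarrow> 'e \<Rightarrow> 'a"
  where "chart_inv c \<equiv> inv_into (fst c) (snd c)"

locale smooth_manifold =
  fixes X :: "'a topology"
    and A :: "('a, 'e::real_normed_vector) chart set"
  assumes finite_dimensional: "\<exists>B::'e set. finite B \<and> span B = UNIV"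
    and Hausdorff: "Hausdorff_space X"
    and second_countable: "second_countable X"
    and chart_domain: "c \<in> A \<Longrightarrow> openin X (fst c)"
    and chart_range: "c \<in> A \<Longrightarrow> open (snd c ` fst c)"
    and chart_homeomorphic: "c \<in> A \<Longrightarrow>
      homeomorphic_map (subtopology X (fst c)) (top_of_set (snd c ` fst c)) (snd c)"
    and charts_cover: "(\<Union>c\<in>A. fst c) = topspace X"
    and charts_compatible: "c \<in> A \<Longrightarrow> d \<in> A \<Longrightarrow>
      smooth_on (snd d \<circ> chart_inv c) (snd c ` (fst c \<inter> fst d))"

definition charts_at :: "('a, 'e) chart set \<Rightarrow> 'a \<Rightarrow> ('a, 'e) chart set"
  where "charts_at A x = {c \<in> A. x \<in> fst c}"

definition transition_derivative ::
    "('a, 'e::real_normed_vector) chart \<Rightarrow> ('a, 'e) chart \<Rightarrow> 'a \<Rightarrow> 'e \<Rightarrow> 'e"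
  where "transition_derivative c d x = frechet_derivative (snd d \<circ> chart_inv c) (at (snd c x))"


section \<open>Tangent spaces\<close>

text \<open>
  A tangent vector at \<open>x\<close> is a family of coordinate vectors, one for each chart around \<open>x\<close>, which
  transforms by the derivatives of the transition maps. The family is zero at all other indices,
  so that equality of tangent vectors is equality of functions; the vector space operations are
  pointwise, with zero vector \<open>\<lambda>_. 0\<close>.
\<close>

type_synonym ('a, 'e) tvector = "('a, 'e) chart \<Rightarrow> 'e"

definition tangent_space ::
    "('a, 'e::real_normed_vector) chart set \<Rightarrow> 'a \<Rightarrow> ('a, 'e) tvector set"
  where "tangent_space A x =
    {v. (\<forall>c. c \<notin> charts_at A x \<longrightarrow> v c = 0) \<and>
        (\<forall>c\<in>charts_at A x. \<forall>d\<in>charts_at A x. v d = transition_derivative c d x (v c))}"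

definition tadd :: "('a, 'e::real_normed_vector) tvector \<Rightarrow> ('a, 'e) tvector \<Rightarrow> ('a, 'e) tvector"
  where "tadd v w = (\<lambda>c. v c + w c)"

definition tscale :: "real \<Rightarrow> ('a, 'e::real_normed_vector) tvector \<Rightarrow> ('a, 'e) tvector"
  where "tscale r v = (\<lambda>c. r *\<^sub>R v c)"

text \<open>The tangent vector at \<open>x\<close> with coordinates \<open>e\<close> in the chart \<open>c\<close>; for fixed \<open>c\<close> and \<open>e\<close> this
  is a coordinate vector field on the domain of \<open>c\<close>.\<close>

definition coord_vector ::
    "('a, 'e::real_normed_vector) chart set \<Rightarrow> ('a, 'e) chart \<Rightarrow> 'e \<Rightarrow> 'a \<Rightarrow> ('a, 'e) tvector"
  where "coord_vector A c e x =
    (\<lambda>d. if d \<in> charts_at A x then transition_derivative c d x e else 0)"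


section \<open>Riemannian manifolds\<close>

locale riemannian_manifold = smooth_manifold X A
  for X :: "'a topology" and A :: "('a, 'e::real_normed_vector) chart set" +
  fixes g :: "'a \<Rightarrow> ('a, 'e) tvector \<Rightarrow> ('a, 'e) tvector \<Rightarrow> real"
  assumes metric_sym: "\<lbrakk>x \<in> topspace X; v \<in> tangent_space A x; w \<in> tangent_space A x\<rbrakk>
      \<Longrightarrow> g x v w = g x w v"
    and metric_add: "\<lbrakk>x \<in> topspace X; u \<in> tangent_space A x; v \<in> tangent_space A x;
        w \<in> tangent_space A x\<rbrakk> \<Longrightarrow> g x (tadd u v) w = g x u w + g x v w"
    and metric_scale: "\<lbrakk>x \<in> topspace X; v \<in> tangent_space A x; w \<in> tangent_space A x\<rbrakk>
      \<Longrightarrow> g x (tscale r v) w = r * g x v w"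
    and metric_pos: "\<lbrakk>x \<in> topspace X; v \<in> tangent_space A x; v \<noteq> (\<lambda>_. 0)\<rbrakk> \<Longrightarrow> 0 < g x v v"
    and metric_smooth: "c \<in> A \<Longrightarrow>
      smooth_on (\<lambda>p. g (chart_inv c p) (coord_vector A c e (chart_inv c p))
                                       (coord_vector A c e' (chart_inv c p)))
        (snd c ` fst c)"

definition rnorm ::
    "('a \<Rightarrow> ('a, 'e) tvector \<Rightarrow> ('a, 'e) tvector \<Rightarrow> real) \<Rightarrow> 'a \<Rightarrow> ('a, 'e) tvector \<Rightarrow> real"
  where "rnorm g x v = sqrt (g x v v)"

definition mfd_differentiable ::
    "('a, 'e::real_normed_vector) chart set \<Rightarrow> ('a \<Rightarrow> real) \<Rightarrow> bool"
  where "mfd_differentiable A f \<longleftrightarrow>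
    (\<forall>c\<in>A. \<forall>x\<in>fst c. (f \<circ> chart_inv c) differentiable (at (snd c x)))"

text \<open>By the chain rule the value on a tangent vector does not depend on the chosen chart.\<close>

definition differential ::
    "('a, 'e::real_normed_vector) chart set \<Rightarrow> ('a \<Rightarrow> real) \<Rightarrow> 'a \<Rightarrow> ('a, 'e) tvector \<Rightarrow> real"
  where "differential A f x v =
    (let c = (SOME c. c \<in> charts_at A x)
     in frechet_derivative (f \<circ> chart_inv c) (at (snd c x)) (v c))"

definition rgradient ::
    "('a, 'e::real_normed_vector) chart set \<Rightarrow>
     ('a \<Rightarrow> ('a, 'e) tvector \<Rightarrow> ('a, 'e) tvector \<Rightarrow> real) \<Rightarrow>
     ('a \<Rightarrow> real) \<Rightarrow> 'a \<Rightarrow> ('a, 'e) tvector"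
  where "rgradient A g f x =
    (THE w. w \<in> tangent_space A x \<and>
            (\<forall>v\<in>tangent_space A x. g x w v = differential A f x v))"


section \<open>Invex sets and smoothness with respect to a map eta\<close>

text \<open>At the endpoints of the unit interval derivatives of curves are one-sided.\<close>

definition differentiable_curve ::
    "'a topology \<Rightarrow> ('a, 'e::real_normed_vector) chart set \<Rightarrow> (real \<Rightarrow> 'a) \<Rightarrow> bool"
  where "differentiable_curve X A \<gamma> \<longleftrightarrow>
    continuous_map (top_of_set {0..1}) X \<gamma> \<and>
    (\<forall>u\<in>{0..1}. \<forall>c\<in>charts_at A (\<gamma> u). (snd c \<circ> \<gamma>) differentiable (at u within {0..1}))"

definition velocity ::
    "('a, 'e::real_normed_vector) chart set \<Rightarrow> (real \<Rightarrow> 'a) \<Rightarrow> real \<Rightarrow> ('a, 'e) tvector"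
  where "velocity A \<gamma> u =
    (\<lambda>c. if c \<in> charts_at A (\<gamma> u)
         then vector_derivative (snd c \<circ> \<gamma>) (at u within {0..1}) else 0)"

definition eta_map ::
    "'a topology \<Rightarrow> ('a, 'e::real_normed_vector) chart set \<Rightarrow> ('a \<Rightarrow> 'a \<Rightarrow> ('a, 'e) tvector) \<Rightarrow> bool"
  where "eta_map X A \<eta> \<longleftrightarrow>
    (\<forall>y\<in>topspace X. \<forall>x\<in>topspace X. \<eta> y x \<in> tangent_space A x)"

definition eta_invex_set ::
    "'a topology \<Rightarrow> ('a, 'e::real_normed_vector) chart set \<Rightarrow>
     ('a \<Rightarrow> 'a \<Rightarrow> ('a, 'e) tvector) \<Rightarrow> 'a set \<Rightarrow> bool"
  where "eta_invex_set X A \<eta> S \<longleftrightarrow>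
    S \<subseteq> topspace X \<and>
    (\<forall>\<gamma>. differentiable_curve X A \<gamma> \<and> \<gamma> 0 \<in> S \<and> \<gamma> 1 \<in> S \<and>
         (\<forall>t\<in>{0..1}. \<forall>u\<in>{0..1}. tscale (t - u) (velocity A \<gamma> u) = \<eta> (\<gamma> t) (\<gamma> u))
       \<longrightarrow> \<gamma> ` {0..1} \<subseteq> S)"

definition L_smooth ::
    "'a topology \<Rightarrow> ('a, 'e::real_normed_vector) chart set \<Rightarrow>
     ('a \<Rightarrow> ('a, 'e) tvector \<Rightarrow> ('a, 'e) tvector \<Rightarrow> real) \<Rightarrow>
     ('a \<Rightarrow> 'a \<Rightarrow> ('a, 'e) tvector) \<Rightarrow> real \<Rightarrow> ('a \<Rightarrow> real) \<Rightarrow> bool"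
  where "L_smooth X A g \<eta> L f \<longleftrightarrow>
    mfd_differentiable A f \<and>
    (\<forall>x\<in>topspace X. \<forall>y\<in>topspace X.
       f y \<le> f x + g x (\<eta> y x) (rgradient A g f x) + L / 2 * (rnorm g x (\<eta> y x))\<^sup>2)"

end

theory Submission
  imports Defs
begin

text \<open>
  The step relation turns L-smoothness into the descent inequality
  \<open>f (x (k + 1)) \<le> f (x k) - \<alpha> * (1 - L * \<alpha> / 2) * \<parallel>\<nabla>f (x k)\<parallel>\<^sup>2\<close>, whose factor is positive
  for \<open>\<alpha> < 2 / L\<close>. So \<open>f (x k)\<close> decreases and is bounded below, hence converges, and its
  consecutive differences dominate the squared gradient norms. The gradient is defined by
  a definite description; no existence argument is needed, because the step relation exhibits it as
  a multiple of the tangent vector \<open>\<eta> (x (k + 1)) (x k)\<close>.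
\<close>

text \<open>\<open>frechet_derivative\<close> is a choice operator and known to be linear only where
  the map is differentiable. Compatibility of the charts supplies this: level \<open>Suc 0\<close>
  of smoothness contains differentiability at every point of the overlap.\<close>

lemma (in smooth_manifold) transition_derivative_scaleR:
  assumes "c \<in> charts_at A x" and "d \<in> charts_at A x"
  shows "transition_derivative c d x (r *\<^sub>R v) = r *\<^sub>R transition_derivative c d x v"
proof -
  have "c \<in> A" "d \<in> A" "x \<in> fst c \<inter> fst d"
    using assms by (auto simp: charts_at_def)
  then have "Ck_on (Suc 0) (snd d \<circ> chart_inv c) (snd c ` (fst c \<inter> fst d))"
    using charts_compatible unfolding smooth_on_def by blast
  then have "(snd d \<circ> chart_inv c) differentiable (at (snd c x))"
    using \<open>x \<in> fst c \<inter> fst d\<close> by auto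
  then show ?thesis
    unfolding transition_derivative_def
    by (intro linear_scale linear_frechet_derivative)
qed

lemma (in smooth_manifold) tscale_in_tangent_space:
  assumes "v \<in> tangent_space A x"
  shows "tscale r v \<in> tangent_space A x"
proof -
  have "tscale r v d = transition_derivative c d x (tscale r v c)"
    if "c \<in> charts_at A x" "d \<in> charts_at A x" for c d
  proof -
    have "v d = transition_derivative c d x (v c)"
      using assms that unfolding tangent_space_def by blast
    then show ?thesis
      unfolding tscale_def using transition_derivative_scaleR[OF that] by metis
  qed
  moreover have "tscale r v c = 0" if "c \<notin> charts_at A x" for c
    using assms that unfolding tangent_space_def tscale_def by (metis (mono_tags, lifting) mem_Collect_eq scaleR_zero_right)
  ultimately show ?thesis
    unfolding tangent_space_def by blast
qed

lemma tscale_tscale: "tscale a (tscale b v) = tscale (a * b) v"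
  by (simp add: tscale_def)

lemma tscale_one [simp]: "tscale 1 v = v"
  by (simp add: tscale_def)

lemma (in riemannian_manifold) metric_nonneg:
  assumes "x \<in> topspace X" and "v \<in> tangent_space A x"
  shows "0 \<le> g x v v"
proof (cases "v = (\<lambda>_. 0)")
  case True
  \<comment> \<open>Positivity covers nonzero vectors only; the zero vector is 0 times itself, so
    homogeneity gives \<open>g x v v = 0\<close>.\<close>
  then have "tscale 0 v = v"
    by (simp add: tscale_def)
  then show ?thesis
    using metric_scale[OF assms(1,2,2), of 0] by simp
next
  case False
  then show ?thesis
    using metric_pos[OF assms] by simp
qed

lemma (in riemannian_manifold) rnorm_square:
  assumes "x \<in> topspace X" and "v \<in> tangent_space A x"
  shows "(rnorm g x v)\<^sup>2 = g x v v"
  using metric_nonneg[OF assms] by (simp add: rnorm_def)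

lemma (in riemannian_manifold) rnorm_tscale:
  assumes "x \<in> topspace X" and "v \<in> tangent_space A x"
  shows "rnorm g x (tscale r v) = \<bar>r\<bar> * rnorm g x v"
proof -
  have tv: "tscale r v \<in> tangent_space A x"
    using assms(2) by (rule tscale_in_tangent_space)
  have "g x (tscale r v) (tscale r v) = r * g x v (tscale r v)"
    by (rule metric_scale[OF assms tv])
  \<comment> \<open>Homogeneity is available in the first argument, so symmetry brings the second
    factor there.\<close>
  also have "g x v (tscale r v) = g x (tscale r v) v"
    by (rule metric_sym[OF assms tv])
  also have "\<dots> = r * g x v v"
    by (rule metric_scale[OF assms assms(2)])
  finally have "g x (tscale r v) (tscale r v) = r\<^sup>2 * g x v v"
    by (simp add: power2_eq_square)
  then show ?thesis
    by (simp add: rnorm_def real_sqrt_mult)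
qed

text \<open>After substituting the step, the linear term contributes -\<alpha> and the quadratic
  term L * \<alpha>^2 / 2 times the squared gradient norm. Tangency of the gradient is a hypothesis
  because it does not follow from unfolding a definite description.\<close>

lemma (in riemannian_manifold) L_smooth_descent:
  assumes "L_smooth X A g \<eta> L f"
    and "x \<in> topspace X" and "y \<in> topspace X"
    and "rgradient A g f x \<in> tangent_space A x"
    and "\<eta> y x = tscale (- \<alpha>) (rgradient A g f x)"
  shows "\<alpha> * (1 - L * \<alpha> / 2) * (rnorm g x (rgradient A g f x))\<^sup>2 \<le> f x - f y"
proof -
  let ?w = "rgradient A g f x"
  have "f y \<le> f x + g x (tscale (- \<alpha>) ?w) ?w + L / 2 * (rnorm g x (tscale (- \<alpha>) ?w))\<^sup>2"
    using assms unfolding L_smooth_def by metis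
  also have "g x (tscale (- \<alpha>) ?w) ?w = - \<alpha> * (rnorm g x ?w)\<^sup>2"
    using assms(2,4) by (simp add: metric_scale rnorm_square)
  also have "(rnorm g x (tscale (- \<alpha>) ?w))\<^sup>2 = \<alpha>\<^sup>2 * (rnorm g x ?w)\<^sup>2"
    using assms(2,4) by (simp add: rnorm_tscale power_mult_distrib)
  finally show ?thesis
    by (simp add: algebra_simps power2_eq_square)
qed

lemma tendsto_zero_if_square_le_decrease:
  fixes a b :: "nat \<Rightarrow> real"
  assumes "0 < c" and bound: "\<And>k. m \<le> b k"
    and decrease: "\<And>k. c * (a k)\<^sup>2 \<le> b k - b (Suc k)"
  shows "a \<longlonglongrightarrow> 0"
proof -
  have "decseq b"
    using \<open>0 < c\<close> decrease
    by (intro decseq_SucI) (smt (verit) mult_nonneg_nonneg zero_le_power2)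
  then obtain l where "b \<longlonglongrightarrow> l"
    using decseq_convergent bound by blast
  \<comment> \<open>The shifted sequence has the same limit \<open>l\<close>, so the differences
    vanish and squeeze the squares.\<close>
  then have "(\<lambda>k. (b k - b (Suc k)) / c) \<longlonglongrightarrow> (l - l) / c"
    using \<open>0 < c\<close> by (intro tendsto_intros LIMSEQ_Suc) auto
  then have "(\<lambda>k. (b k - b (Suc k)) / c) \<longlonglongrightarrow> 0"
    by simp
  moreover have "norm ((a k)\<^sup>2) \<le> (b k - b (Suc k)) / c" for k
    using \<open>0 < c\<close> decrease[of k] by (simp add: field_simps)
  ultimately have "(\<lambda>k. (a k)\<^sup>2) \<longlonglongrightarrow> 0"
    by (rule Lim_null_comparison[OF always_eventually[OF allI], rotated])
  then show ?thesis
    by simp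
qed

theorem theorem3p4:
  fixes X :: "'a topology"
    and A :: "('a, 'e::real_normed_vector) chart set"
    and g :: "'a \<Rightarrow> ('a, 'e) tvector \<Rightarrow> ('a, 'e) tvector \<Rightarrow> real"
    and \<eta> :: "'a \<Rightarrow> 'a \<Rightarrow> ('a, 'e) tvector"
    and f :: "'a \<Rightarrow> real"
    and L B fstar \<alpha> :: real
    and x :: "nat \<Rightarrow> 'a"
  assumes "riemannian_manifold X A g"
    and "eta_map X A \<eta>"
    and "eta_invex_set X A \<eta> (topspace X)"
    and "L > 0"
    and "L_smooth X A g \<eta> L f"
    and "\<exists>x\<^sub>0. is_arg_min f (\<lambda>z. z \<in> topspace X) x\<^sub>0 \<and> f x\<^sub>0 = fstar"
    and "fstar \<ge> B"
    and "0 < \<alpha>" and "\<alpha> < 2 / L"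
    and "\<forall>k. x k \<in> topspace X"
    and "\<forall>k. \<eta> (x (Suc k)) (x k) = tscale (- \<alpha>) (rgradient A g f (x k))"
  shows "(\<lambda>k. rnorm g (x k) (rgradient A g f (x k))) \<longlonglongrightarrow> 0"
proof -
  interpret riemannian_manifold X A g
    by fact
  have "rgradient A g f (x k) \<in> tangent_space A (x k)" for k
  proof -
    \<comment> \<open>As \<alpha> is nonzero, the step relation can be solved for the
      gradient.\<close>
    have "rgradient A g f (x k) = tscale (- 1 / \<alpha>) (\<eta> (x (Suc k)) (x k))"
      using assms(8,11) by (simp add: tscale_tscale)
    moreover have "\<eta> (x (Suc k)) (x k) \<in> tangent_space A (x k)"
      using assms(2,10) by (simp add: eta_map_def)
    ultimately show ?thesis
      using tscale_in_tangent_space by simp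
  qed
  then have descent: "\<alpha> * (1 - L * \<alpha> / 2) * (rnorm g (x k) (rgradient A g f (x k)))\<^sup>2
      \<le> f (x k) - f (x (Suc k))" for k
    using assms(10,11) by (intro L_smooth_descent[OF assms(5)]) auto
  \<comment> \<open>Here the step size bound enters: for L > 0 it says L * \<alpha> / 2 < 1.\<close>
  have "0 < \<alpha> * (1 - L * \<alpha> / 2)"
    using assms(4,8,9) by (simp add: field_simps)
  \<comment> \<open>The attained minimum serves as the lower bound \<open>m\<close>; in a linear
    order, having no smaller value means being least.\<close>
  moreover have "fstar \<le> f (x k)" for k
    using assms(6,10) by (force simp: is_arg_min_linorder)
  ultimately show ?thesis
    using descent by (rule tendsto_zero_if_square_le_decrease)
qed

end
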